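(* Let $f:\mathbb{R}^n\to\mathbb{R}$ be twice continuously differentiable, bounded below by $f_{\mathrm{low}}$, with $M$-Lipschitz continuous Hessian, and suppose that the vectors $\phi_k$ used by the adaptive HSODM satisfy $\|\phi_k-g_k\|\le\varsigma_\phi\|d_k\|^2$ whenever $t_k\neq0$, for a uniform constant $\varsigma_\phi>0$. Then the adaptive HSODM takes $O(\epsilon^{-3/2})$ iterations to achieve a point $x_k$ satisfying $\|\nabla f(x_k)\|\le O(\epsilon)$ and $\lambda_1(\nabla^2f(x_k))\ge\Omega(-\sqrt{\epsilon})$.
   Context: Notation: $g_k=\nabla f(x_k)$, $H_k=\nabla^2f(x_k)$; $\lambda_1(\cdot)$ is the smallest eigenvalue, $\mathcal{S}_1(H_k)$ the eigenspace of $\lambda_1(H_k)$. $M$-Lipschitz Hessian: $\|\nabla^2f(x)-\nabla^2f(y)\|\le M\|x-y\|$ for all $x,y$. The bounds $O(\epsilon)$, $\Omega(-\sqrt\epsilon)$, $O(\epsilon^{-3/2})$ have constants independent of $\epsilon$ and $k$. Generalized homogeneous model (GHM) with data $(H_k,\phi,\delta)$: $\min_{\|[v;t]\|\le1}[v;t]^TF[v;t]$, $F=\begin{bmatrix}H_k&\phi\\ \phi^T&\delta\end{bmatrix}$. An optimal $[v;t]$ has a multiplier $\theta\ge0$ with $F+\theta I\succeq0$, $(F+\theta I)[v;t]=0$, $\theta(\|[v;t]\|-1)=0$. If $t\ne0$, set $d=v/t$ and $h_k(\delta)=\theta^2/\|d\|^2$. Local model: $m_k(d)=f(x_k)+\phi_k^Td+\frac12d^TH_kd+\frac{\sqrt{h_k(\delta_k)}}{3}\|d\|^3$.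 Adaptive HSODM. Parameters: $x_0$, $\delta_0$, $h_{\min}>0$, $0<\eta_1<\eta_2<1$, $\gamma_1>1$, $\gamma_3\ge\gamma_2>1$, $0<\gamma_4\le1$, tolerance $\sigma>0$ (either $\sigma\le\Omega(h_k)$ or a constant $\sigma<h_{\min}$); initially $I_h=\mathbb{R}$. The values $h_k(\delta_k)$ are kept $\ge h_{\min}$. "$\sqrt{h}\in[\sqrt\ell,\sqrt\nu]$ within tolerance $\sigma$" means $\sqrt h\in[\sqrt\ell,\sqrt{\nu+\sigma}]$. Iteration $k$: set $\phi_k=g_k$, start from $\delta_{k,0}=\delta_{k-1}$; for $j=0,1,\dots$ solve the GHM with $(H_k,\phi_k,\delta_{k,j})$; if $t_{k,j}=0$ go to the hard-case procedure below; otherwise, if $\sqrt{h_k(\delta_{k,j})}\in I_h$ within tolerance $\sigma$, set $d_k=v_{k,j}/t_{k,j}$, $\delta_k=\delta_{k,j}$ and stop the inner loop, else update $\delta_{k,j}$ by bisection. Compute $\rho_k=\frac{f(x_k+d_k)-f(x_k)}{m_k(d_k)-f(x_k)}$. If $\rho_k>\eta_2$ (very successful): $I_h=[\max\{\sqrt{h_{\min}},\gamma_4\sqrt{h_k(\delta_k)}\},\sqrt{h_k(\delta_k)}]$, $x_{k+1}=x_k+d_k$. If $\eta_1\le\rho_k\le\eta_2$ (successful): $I_h=[\sqrt{h_k(\delta_k)}/\gamma_1,\gamma_2\sqrt{h_k(\delta_k)}]$, $x_{k+1}=x_k+d_k$. Otherwise (unsuccessful): $I_h=[\gamma_2\sqrt{h_k(\delta_k)},\gamma_3\sqrt{h_k(\delta_k)}]$,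 $x_{k+1}=x_k$. Hard-case procedure at $x_k$ (where $g_k\perp\mathcal{S}_1(H_k)$, $v_k$ a unit eigenvector for $\lambda_1=\lambda_1(H_k)$): for $i=0,1,\dots$ set $\phi_{k+i}=g_k+\frac{\varsigma_\phi}{\gamma_3^2h_{k+i-1}+\sigma}\lambda_1^2v_k$ and $I_h=[\gamma_2\sqrt{h_{k+i-1}},\gamma_3\sqrt{h_{k+i-1}}]$; by bisection find $\delta_{k+i}$ such that the GHM with $(H_k,\phi_{k+i},\delta_{k+i})$ gives $d_{k+i}=v/t$, $h_{k+i}=(\theta/\|d_{k+i}\|)^2$ with $\sqrt{h_{k+i}}\in I_h$ within tolerance $\sigma$; compute the ratio $\rho_{k+i}=\frac{f(x_k+d_{k+i})-f(x_k)}{m(d_{k+i})-f(x_k)}$ where $m$ is the local model with $\phi_{k+i},h_{k+i}$; stop once $\rho_{k+i}\ge\eta_1$, accept the step, and return to the main loop.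
   Formalization: Added assumption: for a fixed B, h_0 ≤ B and h_{k+1} ≤ max(h_k, B) after each very successful iteration (constants may depend on B); without it the tolerance or the hard case lets h_k tend to infinity and the claimed rate fails. *)

theory Defs
  imports "HOL-Analysis.Analysis"
begin

definition eigenvalues :: "real^'n^'n \<Rightarrow> real set" where
  "eigenvalues A = {l. \<exists>u. u \<noteq> 0 \<and> A *v u = l *\<^sub>R u}"

definition lambda1 :: "real^'n^'n \<Rightarrow> real" where
  "lambda1 A = Min (eigenvalues A)"

definition eigenspace1 :: "real^'n^'n \<Rightarrow> (real^'n) set" where
  "eigenspace1 A = {u. A *v u = lambda1 A *\<^sub>R u}"

text \<open>The bordered matrix \<open>F = [H, p; p\<^sup>T, \<delta>]\<close> as an operator on pairs \<open>[v; t]\<close>; inner product and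
  norm of the product space are the Euclidean ones.\<close>

definition ghm_op :: "real^'n^'n \<Rightarrow> real^'n \<Rightarrow> real \<Rightarrow> (real^'n) \<times> real \<Rightarrow> (real^'n) \<times> real" where
  "ghm_op H p \<delta> = (\<lambda>(v, t). (H *v v + t *\<^sub>R p, p \<bullet> v + \<delta> * t))"

definition ghm_optimal :: "real^'n^'n \<Rightarrow> real^'n \<Rightarrow> real \<Rightarrow> (real^'n) \<times> real \<Rightarrow> bool" where
  "ghm_optimal H p \<delta> u \<longleftrightarrow> norm u \<le> 1 \<and>
     (\<forall>w. norm w \<le> 1 \<longrightarrow> u \<bullet> ghm_op H p \<delta> u \<le> w \<bullet> ghm_op H p \<delta> w)"

definition ghm_multiplier ::
    "real^'n^'n \<Rightarrow> real^'n \<Rightarrow> real \<Rightarrow> (real^'n) \<times> real \<Rightarrow> real \<Rightarrow> bool" where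
  "ghm_multiplier H p \<delta> u \<theta> \<longleftrightarrow> 0 \<le> \<theta> \<and>
     (\<forall>w. 0 \<le> w \<bullet> (ghm_op H p \<delta> w + \<theta> *\<^sub>R w)) \<and>
     ghm_op H p \<delta> u + \<theta> *\<^sub>R u = 0 \<and>
     \<theta> * (norm u - 1) = 0"

record 'v ghm_trial =
  del :: real
  solv :: 'v
  solt :: real
  mult :: real

definition ghm_solution :: "real^'n^'n \<Rightarrow> real^'n \<Rightarrow> (real^'n) ghm_trial \<Rightarrow> bool" where
  "ghm_solution H p s \<longleftrightarrow>
     ghm_optimal H p (del s) (solv s, solt s) \<and>
     ghm_multiplier H p (del s) (solv s, solt s) (mult s)"

definition step :: "('v::real_normed_vector) ghm_trial \<Rightarrow> 'v" where
  "step s = (1 / solt s) *\<^sub>R solv s"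

text \<open>If \<open>step s = 0\<close>, then \<open>hval s = 0\<close> by the convention for division, and the requirement
  \<open>hmin \<le> hval s\<close> in \<open>accepted\<close> rejects such a trial.\<close>

definition hval :: "('v::real_normed_vector) ghm_trial \<Rightarrow> real" where
  "hval s = (mult s)\<^sup>2 / (norm (step s))\<^sup>2"

text \<open>\<open>delinit\<close> is the value from which the very first inner loop starts. \<open>hinit\<close> plays the role
  of \<open>h\<^bsub>-1\<^esub>\<close>, which is needed only if the hard case occurs in the very first iteration. \<open>kappa\<close> is
  the constant in the relative tolerance condition, see \<open>hsodm_run\<close>. \<open>zeta\<close> is the constant in
  the bound on the distance of \<open>\<phi>\<^sub>k\<close> from the gradient.\<close>

record hsodm_param =
  delinit :: real
  hinit :: real
  hmin :: real
  eta1 :: real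
  eta2 :: real
  gam1 :: real
  gam2 :: real
  gam3 :: real
  gam4 :: real
  kappa :: real
  zeta :: real

definition valid_param :: "hsodm_param \<Rightarrow> bool" where
  "valid_param P \<longleftrightarrow> 0 < hmin P \<and> hmin P \<le> hinit P \<and>
     0 < eta1 P \<and> eta1 P < eta2 P \<and> eta2 P < 1 \<and>
     1 < gam1 P \<and> 1 < gam2 P \<and> gam2 P \<le> gam3 P \<and> 0 < gam4 P \<and> gam4 P \<le> 1 \<and>
     0 < kappa P \<and> 0 < zeta P"

text \<open>The data of iteration \<open>k\<close>: the point \<open>x\<^sub>k\<close>, the vector \<open>\<phi>\<^sub>k\<close>, the tolerance, the accepted
  solution of the model, whether the iteration belongs to the hard-case procedure, and, if so, the
  eigenvector used there (otherwise \<open>evec\<close> is irrelevant).\<close>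

record 'v iteration =
  pt :: 'v
  phi :: 'v
  tol :: real
  sol :: "'v ghm_trial"
  hard :: bool
  evec :: 'v

definition local_model ::
    "(real^'n \<Rightarrow> real) \<Rightarrow> (real^'n \<Rightarrow> real^'n^'n) \<Rightarrow> real^'n \<Rightarrow> real^'n \<Rightarrow> real \<Rightarrow> real^'n \<Rightarrow> real"
  where
  "local_model f H x p h d =
     f x + p \<bullet> d + (1/2) * (d \<bullet> (H x *v d)) + sqrt h / 3 * norm d ^ 3"

definition rho ::
    "(real^'n \<Rightarrow> real) \<Rightarrow> (real^'n \<Rightarrow> real^'n^'n) \<Rightarrow> (real^'n) iteration \<Rightarrow> real" where
  "rho f H it = (let x = pt it; d = step (sol it) in
     (f (x + d) - f x) / (local_model f H x (phi it) (hval (sol it)) d - f x))"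

text \<open>\<open>None\<close> stands for the whole real line and \<open>Some (a, b)\<close> for the interval \<open>[a, b]\<close>.\<close>

type_synonym interval = "(real \<times> real) option"

definition within_tol :: "real \<Rightarrow> interval \<Rightarrow> real \<Rightarrow> bool" where
  "within_tol \<sigma> I y \<longleftrightarrow>
     (case I of None \<Rightarrow> True | Some (a, b) \<Rightarrow> a \<le> y \<and> y \<le> sqrt (b\<^sup>2 + \<sigma>))"

definition accepted ::
    "hsodm_param \<Rightarrow> real \<Rightarrow> interval \<Rightarrow> ('v::real_normed_vector) ghm_trial \<Rightarrow> bool" where
  "accepted P \<sigma> I s \<longleftrightarrow>
     solt s \<noteq> 0 \<and> hmin P \<le> hval s \<and> within_tol \<sigma> I (sqrt (hval s))"

definition next_interval ::
    "hsodm_param \<Rightarrow> (real^'n \<Rightarrow> real) \<Rightarrow> (real^'n \<Rightarrow> real^'n^'n) \<Rightarrow> (real^'n) iteration \<Rightarrow> interval"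
  where
  "next_interval P f H it = (let q = sqrt (hval (sol it)) in
     if rho f H it > eta2 P then Some (max (sqrt (hmin P)) (gam4 P * q), q)
     else if eta1 P \<le> rho f H it then Some (q / gam1 P, gam2 P * q)
     else Some (gam2 P * q, gam3 P * q))"

definition next_point ::
    "hsodm_param \<Rightarrow> (real^'n \<Rightarrow> real) \<Rightarrow> (real^'n \<Rightarrow> real^'n^'n) \<Rightarrow> (real^'n) iteration \<Rightarrow> real^'n"
  where
  "next_point P f H it =
     (if eta1 P \<le> rho f H it then pt it + step (sol it) else pt it)"

definition cur_interval ::
    "hsodm_param \<Rightarrow> (real^'n \<Rightarrow> real) \<Rightarrow> (real^'n \<Rightarrow> real^'n^'n) \<Rightarrow>
     (nat \<Rightarrow> (real^'n) iteration) \<Rightarrow> nat \<Rightarrow> interval" where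
  "cur_interval P f H r k = (if k = 0 then None else next_interval P f H (r (k - 1)))"

definition prev_h ::
    "hsodm_param \<Rightarrow> (nat \<Rightarrow> ('v::real_normed_vector) iteration) \<Rightarrow> nat \<Rightarrow> real" where
  "prev_h P r k = (if k = 0 then hinit P else hval (sol (r (k - 1))))"

definition prev_del :: "hsodm_param \<Rightarrow> (nat \<Rightarrow> 'v iteration) \<Rightarrow> nat \<Rightarrow> real" where
  "prev_del P r k = (if k = 0 then delinit P else del (sol (r (k - 1))))"

text \<open>The list \<open>ts\<close> of trials of an inner loop: it starts from the given \<open>\<delta>\<close>, and goes on past a
  trial only if that trial has \<open>t \<noteq> 0\<close> and is not accepted. The way in which bisection chooses the
  next \<open>\<delta>\<close> is left open. The last trial is unconstrained here; it is either accepted or the hard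
  case has been detected, see \<open>main_iteration\<close> and \<open>hard_entry\<close>.\<close>

definition inner_loop ::
    "hsodm_param \<Rightarrow> real^'n^'n \<Rightarrow> real^'n \<Rightarrow> real \<Rightarrow> interval \<Rightarrow> real \<Rightarrow>
     (real^'n) ghm_trial list \<Rightarrow> bool" where
  "inner_loop P H p \<sigma> I \<delta> ts \<longleftrightarrow>
     ts \<noteq> [] \<and> del (hd ts) = \<delta> \<and>
     (\<forall>s\<in>set ts. ghm_solution H p s) \<and>
     (\<forall>s\<in>set (butlast ts). solt s \<noteq> 0 \<and> \<not> accepted P \<sigma> I s)"

definition main_iteration ::
    "hsodm_param \<Rightarrow> (real^'n \<Rightarrow> real) \<Rightarrow> (real^'n \<Rightarrow> real^'n) \<Rightarrow> (real^'n \<Rightarrow> real^'n^'n) \<Rightarrow>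
     (nat \<Rightarrow> (real^'n) iteration) \<Rightarrow> nat \<Rightarrow> bool" where
  "main_iteration P f g H r k \<longleftrightarrow> (let it = r k; x = pt it; I = cur_interval P f H r k in
     \<not> hard it \<and> phi it = g x \<and>
     (\<exists>ts. inner_loop P (H x) (phi it) (tol it) I (prev_del P r k) ts \<and>
           last ts = sol it \<and> accepted P (tol it) I (sol it)))"

definition hard_entry ::
    "hsodm_param \<Rightarrow> (real^'n \<Rightarrow> real) \<Rightarrow> (real^'n \<Rightarrow> real^'n) \<Rightarrow> (real^'n \<Rightarrow> real^'n^'n) \<Rightarrow>
     (nat \<Rightarrow> (real^'n) iteration) \<Rightarrow> nat \<Rightarrow> bool" where
  "hard_entry P f g H r k \<longleftrightarrow> (let it = r k; x = pt it in
     (\<exists>ts. inner_loop P (H x) (g x) (tol it) (cur_interval P f H r k) (prev_del P r k) ts \<and>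
           solt (last ts) = 0) \<and>
     (\<forall>u\<in>eigenspace1 (H x). g x \<bullet> u = 0) \<and>
     evec it \<in> eigenspace1 (H x) \<and> norm (evec it) = 1)"

definition hard_iteration ::
    "hsodm_param \<Rightarrow> (real^'n \<Rightarrow> real^'n) \<Rightarrow> (real^'n \<Rightarrow> real^'n^'n) \<Rightarrow>
     (nat \<Rightarrow> (real^'n) iteration) \<Rightarrow> nat \<Rightarrow> bool" where
  "hard_iteration P g H r k \<longleftrightarrow> (let it = r k; x = pt it; h = prev_h P r k in
     hard it \<and>
     phi it = g x + (zeta P / ((gam3 P)\<^sup>2 * h + tol it) * (lambda1 (H x))\<^sup>2) *\<^sub>R evec it \<and>
     ghm_solution (H x) (phi it) (sol it) \<and>
     accepted P (tol it) (Some (gam2 P * sqrt h, gam3 P * sqrt h)) (sol it))"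

text \<open>The hard-case procedure goes on, at the same point and with the same eigenvector, as long as
  its trial steps fail the ratio test.\<close>

definition in_hard_case ::
    "hsodm_param \<Rightarrow> (real^'n \<Rightarrow> real) \<Rightarrow> (real^'n \<Rightarrow> real^'n^'n) \<Rightarrow>
     (nat \<Rightarrow> (real^'n) iteration) \<Rightarrow> nat \<Rightarrow> bool" where
  "in_hard_case P f H r k \<longleftrightarrow> k > 0 \<and> hard (r (k - 1)) \<and> rho f H (r (k - 1)) < eta1 P"

text \<open>\<open>r\<close> records the first \<open>N\<close> iterations from \<open>x0\<close>. Only the point is recorded for index \<open>N\<close>.
  Each trial step of the hard-case procedure counts as an iteration; bisection steps do not. The
  tolerance is either a constant below \<open>hmin\<close> or bounded by a multiple of the value \<open>h\<close> that
  determines the interval it is used with.\<close>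

definition hsodm_run ::
    "hsodm_param \<Rightarrow> (real^'n \<Rightarrow> real) \<Rightarrow> (real^'n \<Rightarrow> real^'n) \<Rightarrow> (real^'n \<Rightarrow> real^'n^'n) \<Rightarrow>
     real^'n \<Rightarrow> nat \<Rightarrow> (nat \<Rightarrow> (real^'n) iteration) \<Rightarrow> bool" where
  "hsodm_run P f g H x0 N r \<longleftrightarrow>
     pt (r 0) = x0 \<and>
     (\<forall>k<N. pt (r (Suc k)) = next_point P f H (r k)) \<and>
     (\<forall>k<N. 0 < tol (r k)) \<and>
     ((\<exists>\<sigma><hmin P. \<forall>k<N. tol (r k) = \<sigma>) \<or> (\<forall>k<N. tol (r k) \<le> kappa P * prev_h P r k)) \<and>
     (\<forall>k<N. if in_hard_case P f H r k
            then hard_iteration P g H r k \<and> evec (r k) = evec (r (k - 1))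
            else main_iteration P f g H r k \<or>
                 hard_entry P f g H r k \<and> hard_iteration P g H r k)"

definition phi_close ::
    "hsodm_param \<Rightarrow> (real^'n \<Rightarrow> real^'n) \<Rightarrow> nat \<Rightarrow> (nat \<Rightarrow> (real^'n) iteration) \<Rightarrow> bool" where
  "phi_close P g N r \<longleftrightarrow> (\<forall>k<N. solt (sol (r k)) \<noteq> 0 \<longrightarrow>
     norm (phi (r k) - g (pt (r k))) \<le> zeta P * (norm (step (sol (r k))))\<^sup>2)"

text \<open>The initial value of \<open>h\<close> is at most \<open>B\<close>, and a very successful iteration does not make \<open>h\<close>
  increase beyond \<open>B\<close>. The rules of the algorithm alone do not give the latter for any \<open>B\<close>: after
  a very successful iteration, \<open>h\<close> may still increase by the tolerance, and by a factor if the
  hard-case procedure is entered. Repeated often enough, this makes \<open>h\<close> unbounded and spoils the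
  rate of convergence. After the other iterations nothing is required.\<close>

definition no_late_increase ::
    "hsodm_param \<Rightarrow> (real^'n \<Rightarrow> real) \<Rightarrow> (real^'n \<Rightarrow> real^'n^'n) \<Rightarrow> real \<Rightarrow>
     nat \<Rightarrow> (nat \<Rightarrow> (real^'n) iteration) \<Rightarrow> bool" where
  "no_late_increase P f H B N r \<longleftrightarrow>
     (0 < N \<longrightarrow> hval (sol (r 0)) \<le> B) \<and>
     (\<forall>k. Suc k < N \<and> rho f H (r k) > eta2 P \<longrightarrow>
        hval (sol (r (Suc k))) \<le> max (hval (sol (r k))) B)"

end

theory Submission
  imports Defs
begin

text \<open>Write \<open>q = sqrt h\<close> for the weight of the cubic term. Optimality of the homogeneous model makes
  an accepted step \<open>d\<close> a minimiser of a quadratic shifted by \<open>\<theta> = q \<parallel>d\<parallel>\<close>: \<open>(H + \<theta> I) d = - \<phi>\<close>,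
  and \<open>H + \<theta> I\<close> is positive semidefinite (\<open>accepted_trial\<close>). So each iteration is a step of cubic
  regularisation with weight \<open>q\<close>, and the classical analysis of that method applies.

  The step decreases the local model by at least \<open>q \<parallel>d\<parallel>\<^sup>3 / 6\<close> (\<open>model_decrease\<close>), hence a successful
  step decreases \<open>f\<close> by at least a fixed multiple of \<open>\<parallel>d\<parallel>\<^sup>3\<close>. As \<open>f\<close> is bounded below, only
  \<open>O(\<epsilon> powr (-3/2))\<close> successful steps can be longer than \<open>sqrt \<epsilon>\<close>. A successful step of length
  at most \<open>sqrt \<epsilon>\<close> leads to a point of the required quality, because the gradient there is
  \<open>O(\<parallel>d\<parallel>\<^sup>2)\<close> (\<open>next_gradient\<close>) and the least eigenvalue is at least \<open>- O(\<parallel>d\<parallel>)\<close>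
  (\<open>next_curvature\<close>), as soon as the weights are bounded.

  The weights are bounded because, once \<open>q \<ge> 3 \<zeta> + M / 2\<close>, the actual decrease is at least the
  predicted one and the iteration is very successful (\<open>ratio_large\<close>); the increase of the weight
  after any other iteration therefore starts below that threshold (\<open>h_bounded\<close>). Unsuccessful
  iterations are paid for by successful ones: they multiply \<open>q\<close> by at least \<open>\<gamma>\<^sub>2\<close>, successful
  iterations divide it by at most a constant, and \<open>ln q\<close> stays in a bounded interval
  (\<open>failures_bounded\<close>). So among the first \<open>O(\<epsilon> powr (-3/2))\<close> iterations there is a short
  successful step.\<close>

section \<open>Taylor expansion with a Lipschitz Hessian\<close>

lemma bounded_growth_on_unit_interval:
  fixes p p' :: "real \<Rightarrow> real"
  assumes deriv: "\<And>s. (p has_real_derivative p' s) (at s)"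
    and bound: "\<And>s. 0 \<le> s \<Longrightarrow> s \<le> 1 \<Longrightarrow> p' s \<le> c * s ^ n"
  shows "p 1 - p 0 \<le> c / real (Suc n)"
proof -
  let ?q = "\<lambda>s. p s - c / real (Suc n) * s ^ Suc n"
  have "?q 1 \<le> ?q 0"
  proof (rule DERIV_nonpos_imp_nonincreasing[where f = ?q])
    fix s :: real
    assume s: "0 \<le> s" "s \<le> 1"
    have "(?q has_real_derivative p' s - c * s ^ n) (at s)"
      by (auto intro!: derivative_eq_intros deriv simp del: power_Suc of_nat_Suc)
    then show "\<exists>y. (?q has_real_derivative y) (at s) \<and> y \<le> 0"
      using bound[OF s] by (intro exI conjI) auto
  qed simp
  then show ?thesis
    by simp
qed

locale lipschitz_hessian =
  fixes f :: "real^'n \<Rightarrow> real"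
    and g :: "real^'n \<Rightarrow> real^'n"
    and H :: "real^'n \<Rightarrow> real^'n^'n"
    and M :: real
  assumes gradient: "\<And>x. GDERIV f x :> g x"
    and hessian: "\<And>x. (g has_derivative (\<lambda>u. H x *v u)) (at x)"
    and hessian_lipschitz: "\<And>x y. onorm (\<lambda>u. (H x - H y) *v u) \<le> M * norm (x - y)"
begin

lemma hessian_difference: "norm ((H x - H y) *v u) \<le> M * norm (x - y) * norm u"
proof -
  have "norm ((H x - H y) *v u) \<le> onorm (\<lambda>u. (H x - H y) *v u) * norm u"
    by (rule onorm) (rule matrix_vector_mul_bounded_linear)
  also have "\<dots> \<le> M * norm (x - y) * norm u"
    by (intro mult_right_mono hessian_lipschitz) simp
  finally show ?thesis .
qed

lemma M_nonneg: "0 \<le> M"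
proof -
  obtain z :: "real^'n" where "norm z = 1"
    using vector_choose_size[of 1] by auto
  then show ?thesis
    using norm_ge_zero[THEN order_trans, OF hessian_difference[of z 0 z]] by simp
qed

lemma line_derivative: "((\<lambda>s. x + s *\<^sub>R d) has_derivative (\<lambda>s. s *\<^sub>R d)) (at s)"
  by (auto intro!: derivative_eq_intros)

lemma gradient_along_line:
  "((\<lambda>s. g (x + s *\<^sub>R d) \<bullet> w) has_real_derivative (H (x + s *\<^sub>R d) *v d) \<bullet> w) (at s)"
proof -
  have "((\<lambda>s. g (x + s *\<^sub>R d)) has_derivative (\<lambda>s'. H (x + s *\<^sub>R d) *v (s' *\<^sub>R d))) (at s)"
    using diff_chain_at[OF line_derivative hessian] by (simp add: o_def)
  then have "((\<lambda>s. g (x + s *\<^sub>R d) \<bullet> w) has_derivative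
      (\<lambda>s'. (H (x + s *\<^sub>R d) *v (s' *\<^sub>R d)) \<bullet> w)) (at s)"
    by (rule has_derivative_inner_left)
  then show ?thesis
    by (simp add: has_field_derivative_def matrix_vector_mult_scaleR mult_commute_abs)
qed

lemma function_along_line:
  "((\<lambda>s. f (x + s *\<^sub>R d)) has_real_derivative g (x + s *\<^sub>R d) \<bullet> d) (at s)"
proof -
  have "(f has_derivative (\<lambda>u. u \<bullet> g (x + s *\<^sub>R d))) (at (x + s *\<^sub>R d))"
    using gradient[of "x + s *\<^sub>R d"] by (simp add: gderiv_def)
  from diff_chain_at[OF line_derivative this]
  show ?thesis
    by (simp add: has_field_derivative_def o_def mult_commute_abs inner_commute)
qed

text \<open>The growth bound along the segment from \<open>x\<close> to \<open>x + d\<close>, applied to the component of the gradient in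
  the direction of the remainder itself.\<close>

lemma gradient_expansion: "norm (g (x + d) - g x - H x *v d) \<le> M / 2 * (norm d)\<^sup>2"
proof -
  define w where "w = g (x + d) - g x - H x *v d"
  let ?p = "\<lambda>s. g (x + s *\<^sub>R d) \<bullet> w - s * ((H x *v d) \<bullet> w)"
  have "?p 1 - ?p 0 \<le> M * (norm d)\<^sup>2 * norm w / real (Suc 1)"
  proof (rule bounded_growth_on_unit_interval)
    fix s :: real
    show "(?p has_real_derivative (H (x + s *\<^sub>R d) *v d) \<bullet> w - (H x *v d) \<bullet> w) (at s)"
      by (rule derivative_eq_intros gradient_along_line refl)+ simp
    assume s: "0 \<le> s" "s \<le> 1"
    have "(H (x + s *\<^sub>R d) *v d) \<bullet> w - (H x *v d) \<bullet> w
        = ((H (x + s *\<^sub>R d) - H x) *v d) \<bullet> w"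
      by (simp add: matrix_vector_mult_diff_rdistrib inner_diff_left)
    also have "\<dots> \<le> norm ((H (x + s *\<^sub>R d) - H x) *v d) * norm w"
      by (rule norm_cauchy_schwarz)
    also have "\<dots> \<le> (M * norm (s *\<^sub>R d) * norm d) * norm w"
      using hessian_difference[of "x + s *\<^sub>R d" x d] by (intro mult_right_mono) auto
    also have "\<dots> = M * (norm d)\<^sup>2 * norm w * s ^ 1"
      using s by (simp add: power2_eq_square)
    finally show "(H (x + s *\<^sub>R d) *v d) \<bullet> w - (H x *v d) \<bullet> w \<le> M * (norm d)\<^sup>2 * norm w * s ^ 1" .
  qed
  moreover have "?p 1 - ?p 0 = norm w * norm w"
    by (simp add: w_def inner_diff_left flip: power2_eq_square power2_norm_eq_inner)
       (simp add: power2_norm_eq_inner inner_diff_left)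
  ultimately have "norm w * norm w \<le> (M / 2 * (norm d)\<^sup>2) * norm w"
    by simp
  then have "norm w \<le> M / 2 * (norm d)\<^sup>2"
    using M_nonneg by (cases "w = 0") (simp_all add: mult_le_cancel_right)
  then show ?thesis
    by (simp add: w_def)
qed

lemma function_expansion:
  "\<bar>f (x + d) - f x - g x \<bullet> d - (1/2) * ((H x *v d) \<bullet> d)\<bar> \<le> M / 6 * norm d ^ 3"
proof -
  let ?e = "\<lambda>s. g (x + s *\<^sub>R d) \<bullet> d - g x \<bullet> d - s * ((H x *v d) \<bullet> d)"
  have bound: "\<bar>?e s\<bar> \<le> M / 2 * norm d ^ 3 * s\<^sup>2" if "0 \<le> s" for s
  proof -
    have "?e s = (g (x + s *\<^sub>R d) - g x - H x *v (s *\<^sub>R d)) \<bullet> d"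
      by (simp add: inner_diff_left matrix_vector_mult_scaleR)
    then have "\<bar>?e s\<bar> \<le> norm (g (x + s *\<^sub>R d) - g x - H x *v (s *\<^sub>R d)) * norm d"
      by (simp only: Cauchy_Schwarz_ineq2)
    also have "\<dots> \<le> M / 2 * (norm (s *\<^sub>R d))\<^sup>2 * norm d"
      by (intro mult_right_mono gradient_expansion) simp
    also have "\<dots> = M / 2 * norm d ^ 3 * s\<^sup>2"
      by (simp add: power_mult_distrib power2_eq_square power3_eq_cube)
    finally show ?thesis .
  qed
  let ?p = "\<lambda>c s. c * (f (x + s *\<^sub>R d) - s * (g x \<bullet> d) - s\<^sup>2 * ((1/2) * ((H x *v d) \<bullet> d)))"
  have "?p c 1 - ?p c 0 \<le> M / 2 * norm d ^ 3 / real (Suc 2)" if "c = 1 \<or> c = -1" for c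
  proof (rule bounded_growth_on_unit_interval)
    fix s :: real
    show "(?p c has_real_derivative c * ?e s) (at s)"
      by (auto intro!: derivative_eq_intros function_along_line)
    assume "0 \<le> s" "s \<le> 1"
    have "c * ?e s \<le> \<bar>?e s\<bar>"
      using that by auto
    also have "\<dots> \<le> M / 2 * norm d ^ 3 * s\<^sup>2"
      using \<open>0 \<le> s\<close> by (rule bound)
    finally show "c * ?e s \<le> M / 2 * norm d ^ 3 * s\<^sup>2" .
  qed
  from this[of 1] this[of "-1"] show ?thesis
    by simp argo
qed

text \<open>Needed for the Hessian to have real eigenvalues. Expand \<open>f (x + t u + t w)\<close> to second order in two
  ways: directly at \<open>x\<close>, or at \<open>x + t u\<close> with all terms there expanded at \<open>x\<close> in turn. The
  terms of order \<open>t\<^sup>2\<close> differ by half the asymmetry of the Hessian, and the remainders are of order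
  \<open>t\<^sup>3\<close>.\<close>

lemma hessian_symmetric: "(H x *v u) \<bullet> w = (H x *v w) \<bullet> u"
proof -
  let ?Q = "\<lambda>u w. (H x *v u) \<bullet> w"
  define c where "c = M / 6 * norm (u + w) ^ 3 + M / 6 * norm u ^ 3 + M / 6 * norm w ^ 3
    + M * norm u * norm w * norm w / 2 + M / 2 * (norm u)\<^sup>2 * norm w"
  have small: "\<bar>?Q w u - ?Q u w\<bar> / 2 \<le> c * t" if t: "0 < t" for t
  proof -
    let ?u = "t *\<^sub>R u" and ?w = "t *\<^sub>R w"
    \<comment> \<open>Bounds 1 to 3 are the expansions of \<open>f\<close>; 4 and 5 replace the derivatives at \<open>x + t u\<close>
      that occur in 3 by those at \<open>x\<close>.\<close>
    have 1: "\<bar>f (x + (?u + ?w)) - f x - g x \<bullet> (?u + ?w) - (1/2) * ?Q (?u + ?w) (?u + ?w)\<bar>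
        \<le> M / 6 * norm (u + w) ^ 3 * t ^ 3"
      using function_expansion[of x "?u + ?w"] t
      by (simp add: power_mult_distrib ac_simps flip: scaleR_add_right)
    have 2: "\<bar>f (x + ?u) - f x - g x \<bullet> ?u - (1/2) * ?Q ?u ?u\<bar> \<le> M / 6 * norm u ^ 3 * t ^ 3"
      using function_expansion[of x ?u] t by (simp add: power_mult_distrib ac_simps)
    have 3: "\<bar>f (x + (?u + ?w)) - f (x + ?u) - g (x + ?u) \<bullet> ?w
        - (1/2) * ((H (x + ?u) *v ?w) \<bullet> ?w)\<bar> \<le> M / 6 * norm w ^ 3 * t ^ 3"
      using function_expansion[of "x + ?u" ?w] t by (simp add: power_mult_distrib ac_simps)
    have "\<bar>((H (x + ?u) - H x) *v ?w) \<bullet> ?w\<bar> \<le> norm ((H (x + ?u) - H x) *v ?w) * norm ?w"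
      by (rule Cauchy_Schwarz_ineq2)
    also have "\<dots> \<le> (M * norm ?u * norm ?w) * norm ?w"
      using hessian_difference[of "x + ?u" x ?w] by (intro mult_right_mono) auto
    also have "\<dots> = M * norm u * norm w * norm w * t ^ 3"
      using t by (simp add: power3_eq_cube)
    finally have 4: "\<bar>(H (x + ?u) *v ?w) \<bullet> ?w - ?Q ?w ?w\<bar> \<le> M * norm u * norm w * norm w * t ^ 3"
      by (simp only: matrix_vector_mult_diff_rdistrib inner_diff_left)
    have "\<bar>(g (x + ?u) - g x - H x *v ?u) \<bullet> ?w\<bar> \<le> norm (g (x + ?u) - g x - H x *v ?u) * norm ?w"
      by (rule Cauchy_Schwarz_ineq2)
    also have "\<dots> \<le> (M / 2 * (norm ?u)\<^sup>2) * norm ?w"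
      by (intro mult_right_mono gradient_expansion) simp
    also have "\<dots> = M / 2 * (norm u)\<^sup>2 * norm w * t ^ 3"
      using t by (simp add: power3_eq_cube power2_eq_square)
    finally have 5: "\<bar>g (x + ?u) \<bullet> ?w - g x \<bullet> ?w - ?Q ?u ?w\<bar> \<le> M / 2 * (norm u)\<^sup>2 * norm w * t ^ 3"
      by (simp only: inner_diff_left)
    have 6: "?Q (?u + ?w) (?u + ?w) = ?Q ?u ?u + ?Q ?u ?w + ?Q ?w ?u + ?Q ?w ?w"
      by (simp only: matrix_vector_right_distrib inner_add_left inner_add_right)
    have 7: "g x \<bullet> (?u + ?w) = g x \<bullet> ?u + g x \<bullet> ?w"
      by (simp add: inner_add_right)
    have 8: "c * t ^ 3 = M / 6 * norm (u + w) ^ 3 * t ^ 3 + M / 6 * norm u ^ 3 * t ^ 3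
        + M / 6 * norm w ^ 3 * t ^ 3 + M * norm u * norm w * norm w * t ^ 3 / 2
        + M / 2 * (norm u)\<^sup>2 * norm w * t ^ 3"
      by (simp add: c_def ring_distribs)
    have "\<bar>?Q ?w ?u - ?Q ?u ?w\<bar> / 2 \<le> c * t ^ 3"
      using 1 2 3 4 5 unfolding 6 7 8 by argo
    then have "t\<^sup>2 * (\<bar>?Q w u - ?Q u w\<bar> / 2) \<le> t\<^sup>2 * (c * t)"
      by (simp add: matrix_vector_mult_scaleR power2_eq_square power3_eq_cube abs_mult
          flip: right_diff_distrib mult.assoc) (simp add: ac_simps)
    then show ?thesis
      using t by simp
  qed
  have "\<bar>?Q w u - ?Q u w\<bar> / 2 \<le> 0"
  proof (rule tendsto_lowerbound)
    show "((\<lambda>t. c * t) \<longlongrightarrow> 0) (at_right 0)"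
      by (auto intro!: tendsto_eq_intros)
    show "\<forall>\<^sub>F t in at_right 0. \<bar>?Q w u - ?Q u w\<bar> / 2 \<le> c * t"
      using small by (auto simp: eventually_at_right_field intro!: exI[of _ 1])
  qed simp
  then show ?thesis
    by simp
qed

end

section \<open>The least eigenvalue of a symmetric matrix\<close>

text \<open>The constant \<^const>\<open>lambda1\<close> is a minimum, which is meaningful only over a finite nonempty set.
  Eigenvectors for distinct eigenvalues are orthogonal, so there are at most as many eigenvalues
  as dimensions.\<close>

lemma finite_eigenvalues_symmetric:
  fixes A :: "real^'n^'n"
  assumes sym: "\<And>u w. (A *v u) \<bullet> w = (A *v w) \<bullet> u"
  shows "finite (eigenvalues A)"
proof -
  have "\<forall>l\<in>eigenvalues A. \<exists>u. u \<noteq> 0 \<and> A *v u = l *\<^sub>R u"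
    by (simp add: eigenvalues_def)
  then obtain e where e: "\<And>l. l \<in> eigenvalues A \<Longrightarrow> e l \<noteq> 0 \<and> A *v e l = l *\<^sub>R e l"
    by metis
  have orth: "e l \<bullet> e l' = 0" if "l \<in> eigenvalues A" "l' \<in> eigenvalues A" "l \<noteq> l'" for l l'
  proof -
    have "l * (e l \<bullet> e l') = l' * (e l \<bullet> e l')"
      using sym[of "e l" "e l'"] e[OF that(1)] e[OF that(2)] by (simp add: inner_commute)
    with that(3) show ?thesis
      by simp
  qed
  have inj: "inj_on e (eigenvalues A)"
    using orth e by (metis inj_onI inner_eq_zero_iff)
  have "pairwise orthogonal (e ` eigenvalues A)"
    using orth by (auto simp: pairwise_def orthogonal_def)
  moreover have "0 \<notin> e ` eigenvalues A"
    using e by force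
  ultimately have "independent (e ` eigenvalues A)"
    by (rule pairwise_orthogonal_independent)
  then show ?thesis
    using inj independent_imp_finite finite_imageD by blast
qed

text \<open>A minimiser \<open>u\<close> of the quadratic form on the unit sphere is an eigenvector. Otherwise the form of
  \<open>A - l I\<close>, where \<open>l\<close> is the minimum, would become negative at \<open>u - t z\<close> for the residual
  \<open>z = A u - l u\<close> and small \<open>t > 0\<close>.\<close>

lemma eigenvalue_exists_symmetric:
  fixes A :: "real^'n^'n"
  assumes sym: "\<And>u w. (A *v u) \<bullet> w = (A *v w) \<bullet> u"
  shows "eigenvalues A \<noteq> {}"
proof -
  have "\<exists>u\<in>sphere 0 1. \<forall>w\<in>sphere 0 1. (A *v u) \<bullet> u \<le> (A *v w) \<bullet> (w :: real^'n)"
  proof (rule continuous_attains_inf)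
    show "continuous_on (sphere 0 1) (\<lambda>u. (A *v u) \<bullet> u)"
      by (intro continuous_intros linear_continuous_on matrix_vector_mul_bounded_linear)
    show "sphere (0 :: real^'n) 1 \<noteq> {}"
      using vector_choose_size[of 1] by auto
  qed auto
  then obtain u :: "real^'n" where u: "norm u = 1"
    and least: "\<And>w. norm w = 1 \<Longrightarrow> (A *v u) \<bullet> u \<le> (A *v w) \<bullet> w"
    by auto
  define l where "l = (A *v u) \<bullet> u"
  define z where "z = A *v u - l *\<^sub>R u"
  have psd: "l * (w \<bullet> w) \<le> (A *v w) \<bullet> w" for w :: "real^'n"
  proof (cases "w = 0")
    case False
    have "l \<le> (A *v ((1 / norm w) *\<^sub>R w)) \<bullet> ((1 / norm w) *\<^sub>R w)"
      unfolding l_def using False by (intro least) simp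
    also have "\<dots> = (A *v w) \<bullet> w / (w \<bullet> w)"
      by (simp add: matrix_vector_mult_scaleR power2_eq_square flip: power2_norm_eq_inner)
    finally show ?thesis
      using False by (simp add: pos_le_divide_eq)
  qed simp
  have expand: "0 \<le> 2 * s * (z \<bullet> z) + s\<^sup>2 * ((A *v z) \<bullet> z - l * (z \<bullet> z))" for s
  proof -
    have uu: "u \<bullet> u = 1"
      using u by (simp add: norm_eq_1)
    have uz: "u \<bullet> z = 0"
      by (simp add: z_def inner_diff_right uu l_def inner_commute)
    have Auz: "(A *v u) \<bullet> z = z \<bullet> z"
      using uz arg_cong[OF z_def, of "\<lambda>y. y \<bullet> z"] by (simp add: inner_diff_left)
    have "(A *v (u + s *\<^sub>R z)) \<bullet> (u + s *\<^sub>R z) = l + 2 * s * (z \<bullet> z) + s\<^sup>2 * ((A *v z) \<bullet> z)"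
      using Auz sym[of z u]
      by (simp add: matrix_vector_right_distrib matrix_vector_mult_scaleR inner_add_left
          inner_add_right power2_eq_square l_def ring_distribs)
    moreover have "(u + s *\<^sub>R z) \<bullet> (u + s *\<^sub>R z) = 1 + s\<^sup>2 * (z \<bullet> z)"
      using uu uz by (simp add: inner_add_left inner_add_right inner_commute power2_eq_square)
    ultimately show ?thesis
      using psd[of "u + s *\<^sub>R z"] by (simp add: algebra_simps)
  qed
  have "z \<bullet> z \<le> 0"
  proof -
    define b where "b = (A *v z) \<bullet> z - l * (z \<bullet> z)"
    have "2 * (z \<bullet> z) \<le> b * t" if t: "0 < t" for t
    proof -
      have "t * (2 * (z \<bullet> z)) \<le> t * (b * t)"
        using expand[of "- t"] by (simp add: b_def power2_eq_square algebra_simps)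
      with t show ?thesis by simp
    qed
    moreover have "((\<lambda>t. b * t) \<longlongrightarrow> 0) (at_right 0)"
      by (auto intro!: tendsto_eq_intros)
    ultimately have "2 * (z \<bullet> z) \<le> 0"
      by (intro tendsto_lowerbound[of "\<lambda>t. b * t" 0 "at_right 0"])
         (auto simp: eventually_at_right_field intro!: exI[of _ 1])
    then show ?thesis by simp
  qed
  then have "z = 0"
    by (metis inner_gt_zero_iff not_le)
  moreover have "u \<noteq> 0"
    using u by auto
  ultimately show ?thesis
    by (auto simp: eigenvalues_def z_def)
qed

lemma lambda1_lower_bound:
  fixes A :: "real^'n^'n"
  assumes sym: "\<And>u w. (A *v u) \<bullet> w = (A *v w) \<bullet> u"
    and bound: "\<And>u. c * (u \<bullet> u) \<le> (A *v u) \<bullet> u"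
  shows "c \<le> lambda1 A"
proof -
  have "lambda1 A \<in> eigenvalues A"
    unfolding lambda1_def
    using finite_eigenvalues_symmetric[OF sym] eigenvalue_exists_symmetric[OF sym] by (rule Min_in)
  then obtain u where u: "u \<noteq> 0" "A *v u = lambda1 A *\<^sub>R u"
    by (auto simp: eigenvalues_def)
  with bound[of u] show ?thesis
    by simp
qed

section \<open>Steps of the homogeneous model\<close>

text \<open>The first row of the eigenvector equation for the bordered matrix, divided by \<open>t\<close>, is a regularised
  Newton equation. Testing positive semidefiniteness of the bordered matrix with vectors whose last
  component is \<open>0\<close> bounds the curvature of \<open>A\<close> from below.\<close>

lemma accepted_trial:
  fixes s :: "(real^'n) ghm_trial"
  assumes sol: "ghm_solution A p s" and t: "solt s \<noteq> 0" and h: "0 < hval s"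
  shows step_nonzero: "step s \<noteq> 0"
    and multiplier_eq: "mult s = sqrt (hval s) * norm (step s)"
    and shifted_newton: "A *v step s + mult s *\<^sub>R step s = - p"
    and shifted_psd: "- mult s * (w \<bullet> w) \<le> (A *v w) \<bullet> w"
proof -
  show step: "step s \<noteq> 0"
    using h by (auto simp: hval_def)
  have m: "ghm_multiplier A p (del s) (solv s, solt s) (mult s)"
    using sol by (simp add: ghm_solution_def)
  then have m0: "0 \<le> mult s"
    by (simp add: ghm_multiplier_def)
  then show "mult s = sqrt (hval s) * norm (step s)"
    using step by (simp add: hval_def real_sqrt_divide)
  have "A *v solv s + solt s *\<^sub>R p + mult s *\<^sub>R solv s = 0"
    using m by (simp add: ghm_multiplier_def ghm_op_def zero_prod_def)
  then have "(1 / solt s) *\<^sub>R (A *v solv s + solt s *\<^sub>R p + mult s *\<^sub>R solv s) = 0"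
    by simp
  then have "A *v step s + mult s *\<^sub>R step s + p = 0"
    using t by (simp add: step_def matrix_vector_mult_scaleR scaleR_add_right ac_simps)
  then show "A *v step s + mult s *\<^sub>R step s = - p"
    by (simp add: eq_neg_iff_add_eq_0)
  have "0 \<le> (w, 0) \<bullet> (ghm_op A p (del s) (w, 0) + mult s *\<^sub>R (w, 0))"
    using m by (simp only: ghm_multiplier_def)
  then show "- mult s * (w \<bullet> w) \<le> (A *v w) \<bullet> w"
    by (simp add: ghm_op_def inner_add_right inner_commute)
qed

text \<open>Eliminating \<open>p\<close> by the regularised Newton equation leaves \<open>- (d \<bullet> H d + \<theta> \<parallel>d\<parallel>\<^sup>2) / 2\<close>, which is
  nonpositive, and \<open>- \<theta> \<parallel>d\<parallel>\<^sup>2 / 2 + q \<parallel>d\<parallel>\<^sup>3 / 3\<close> with \<open>q = sqrt h\<close>. Since \<open>\<theta> = q \<parallel>d\<parallel>\<close>, the latter is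
  \<open>- q \<parallel>d\<parallel>\<^sup>3 / 6\<close>.\<close>

lemma model_decrease:
  fixes s :: "(real^'n) ghm_trial"
  assumes sol: "ghm_solution (H x) p s" and t: "solt s \<noteq> 0" and h: "0 < hval s"
  shows "local_model f H x p (hval s) (step s) - f x \<le> - (sqrt (hval s) / 6 * norm (step s) ^ 3)"
proof -
  let ?d = "step s" and ?q = "sqrt (hval s)"
  note trial = accepted_trial[OF sol t h]
  have "p = - (H x *v ?d + mult s *\<^sub>R ?d)"
    using trial(3) by simp
  then have "p \<bullet> ?d = - ((H x *v ?d) \<bullet> ?d) - mult s * (?d \<bullet> ?d)"
    by (simp add: inner_diff_left inner_add_left)
  moreover have "mult s * (?d \<bullet> ?d) = ?q * norm ?d ^ 3"
    using trial(2) by (simp add: power3_eq_cube power2_eq_square flip: power2_norm_eq_inner)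
  moreover have "- mult s * (?d \<bullet> ?d) \<le> (H x *v ?d) \<bullet> ?d"
    by (rule trial(4))
  ultimately show ?thesis
    by (simp add: local_model_def inner_commute field_simps)
qed

context lipschitz_hessian
begin

lemma actual_minus_model:
  assumes close: "norm (p - g x) \<le> z * (norm d)\<^sup>2"
  shows "f (x + d) - local_model f H x p h d \<le> (z + M / 6 - sqrt h / 3) * norm d ^ 3"
proof -
  have "(g x - p) \<bullet> d \<le> norm (g x - p) * norm d"
    by (rule norm_cauchy_schwarz)
  also have "\<dots> \<le> (z * (norm d)\<^sup>2) * norm d"
    using close by (intro mult_right_mono) (simp_all add: norm_minus_commute)
  finally have "(g x - p) \<bullet> d \<le> z * norm d ^ 3"
    by (simp add: power2_eq_square power3_eq_cube)
  then show ?thesis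
    using function_expansion[of x d]
    by (simp add: local_model_def inner_commute inner_diff_left algebra_simps) argo
qed

text \<open>At this weight the cubic term of the model outweighs both the Taylor remainder and the error in the
  gradient, so the actual decrease is at least the predicted one.\<close>

lemma ratio_large:
  assumes sol: "ghm_solution (H (pt it)) (phi it) (sol it)"
    and t: "solt (sol it) \<noteq> 0" and h: "0 < hval (sol it)"
    and close: "norm (phi it - g (pt it)) \<le> z * (norm (step (sol it)))\<^sup>2"
    and large: "3 * z + M / 2 \<le> sqrt (hval (sol it))"
  shows "1 \<le> rho f H it"
proof -
  let ?x = "pt it" and ?s = "sol it"
  let ?m = "local_model f H ?x (phi it) (hval ?s) (step ?s)"
  have "0 < sqrt (hval ?s) / 6 * norm (step ?s) ^ 3"
    using h step_nonzero[OF sol t h] by simp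
  then have "?m - f ?x < 0"
    using model_decrease[where H = H and x = ?x, OF sol t h, of f] by linarith
  moreover have "(z + M / 6 - sqrt (hval ?s) / 3) * norm (step ?s) ^ 3 \<le> 0"
    using large by (intro mult_nonpos_nonneg) auto
  then have "f (?x + step ?s) - f ?x \<le> ?m - f ?x"
    using actual_minus_model[OF close, of "hval ?s"] by linarith
  ultimately show ?thesis
    by (simp add: rho_def Let_def le_divide_eq)
qed

lemma successful_decrease:
  assumes sol: "ghm_solution (H (pt it)) (phi it) (sol it)"
    and t: "solt (sol it) \<noteq> 0" and h: "0 < hval (sol it)"
    and ratio: "\<eta> \<le> rho f H it" and \<eta>: "0 \<le> \<eta>"
  shows "f (pt it + step (sol it)) \<le>
    f (pt it) - \<eta> * (sqrt (hval (sol it)) / 6 * norm (step (sol it)) ^ 3)"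
proof -
  let ?x = "pt it" and ?s = "sol it"
  let ?m = "local_model f H ?x (phi it) (hval ?s) (step ?s)"
  let ?c = "sqrt (hval ?s) / 6 * norm (step ?s) ^ 3"
  have "0 < ?c"
    using h step_nonzero[OF sol t h] by simp
  moreover have m: "?m - f ?x \<le> - ?c"
    by (rule model_decrease[where H = H and x = ?x, OF sol t h])
  ultimately have "f (?x + step ?s) - f ?x \<le> \<eta> * (?m - f ?x)"
    using ratio by (simp add: rho_def Let_def le_divide_eq)
  also have "\<dots> \<le> \<eta> * - ?c"
    using m \<eta> by (rule mult_left_mono)
  finally show ?thesis
    by simp
qed

text \<open>By the regularised Newton equation, the first-order expansion \<open>g x + H d\<close> of the new gradient equals
  \<open>(g x - \<phi>) - \<theta> d\<close>, and \<open>\<theta> \<parallel>d\<parallel> = sqrt h \<parallel>d\<parallel>\<^sup>2\<close>.\<close>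

lemma next_gradient:
  assumes sol: "ghm_solution (H (pt it)) (phi it) (sol it)"
    and t: "solt (sol it) \<noteq> 0" and h: "0 < hval (sol it)"
    and close: "norm (phi it - g (pt it)) \<le> z * (norm (step (sol it)))\<^sup>2"
  shows "norm (g (pt it + step (sol it))) \<le>
    (M / 2 + z + sqrt (hval (sol it))) * (norm (step (sol it)))\<^sup>2"
proof -
  let ?x = "pt it" and ?d = "step (sol it)" and ?\<theta> = "mult (sol it)"
  have "H ?x *v ?d = - phi it - ?\<theta> *\<^sub>R ?d"
    using shifted_newton[OF sol t h] by (simp add: eq_diff_eq)
  then have "g (?x + ?d) = (g (?x + ?d) - g ?x - H ?x *v ?d) - (phi it - g ?x) - ?\<theta> *\<^sub>R ?d"
    by simp
  then have "norm (g (?x + ?d))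
      = norm ((g (?x + ?d) - g ?x - H ?x *v ?d) - (phi it - g ?x) - ?\<theta> *\<^sub>R ?d)"
    by (rule arg_cong)
  also have "\<dots> \<le> norm (g (?x + ?d) - g ?x - H ?x *v ?d)
      + norm (phi it - g ?x) + norm (?\<theta> *\<^sub>R ?d)"
    by (intro order_trans[OF norm_triangle_ineq4] add_mono norm_triangle_ineq4 order_refl)
  finally have "norm (g (?x + ?d)) \<le> norm (g (?x + ?d) - g ?x - H ?x *v ?d)
      + norm (phi it - g ?x) + norm (?\<theta> *\<^sub>R ?d)" .
  moreover have "norm (?\<theta> *\<^sub>R ?d) = sqrt (hval (sol it)) * (norm ?d)\<^sup>2"
    using h by (simp add: multiplier_eq[OF sol t h] power2_eq_square abs_mult)
  ultimately show ?thesis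
    using gradient_expansion[of ?x ?d] close by (simp add: algebra_simps)
qed

text \<open>The curvature at the old point is at least \<open>- \<theta> = - sqrt h \<parallel>d\<parallel>\<close>, and the Hessian changes by at most
  \<open>M \<parallel>d\<parallel>\<close> over the step.\<close>

lemma next_curvature:
  assumes sol: "ghm_solution (H (pt it)) (phi it) (sol it)"
    and t: "solt (sol it) \<noteq> 0" and h: "0 < hval (sol it)"
  shows "- ((M + sqrt (hval (sol it))) * norm (step (sol it))) \<le> lambda1 (H (pt it + step (sol it)))"
proof (rule lambda1_lower_bound[OF hessian_symmetric])
  fix u
  let ?x = "pt it" and ?d = "step (sol it)"
  have "\<bar>((H (?x + ?d) - H ?x) *v u) \<bullet> u\<bar> \<le> norm ((H (?x + ?d) - H ?x) *v u) * norm u"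
    by (rule Cauchy_Schwarz_ineq2)
  also have "\<dots> \<le> (M * norm ?d * norm u) * norm u"
    using hessian_difference[of "?x + ?d" ?x u] by (intro mult_right_mono) auto
  also have "\<dots> = M * norm ?d * (u \<bullet> u)"
    by (simp add: power2_eq_square flip: power2_norm_eq_inner)
  finally have "\<bar>(H (?x + ?d) *v u) \<bullet> u - (H ?x *v u) \<bullet> u\<bar> \<le> M * norm ?d * (u \<bullet> u)"
    by (simp only: matrix_vector_mult_diff_rdistrib inner_diff_left)
  moreover have "- (sqrt (hval (sol it)) * norm ?d) * (u \<bullet> u) \<le> (H ?x *v u) \<bullet> u"
    using shifted_psd[OF sol t h, of u] by (simp add: multiplier_eq[OF sol t h])
  ultimately show "- ((M + sqrt (hval (sol it))) * norm ?d) * (u \<bullet> u) \<le> (H (?x + ?d) *v u) \<bullet> u"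
    by (simp add: ring_distribs)
qed

end

section \<open>Counting failures by a potential\<close>

text \<open>The total rise of the potential \<open>q\<close>, at least \<open>e\<close> per failure, is limited by the room \<open>b - a\<close> plus
  the total drop, at most \<open>c\<close> per success. The last summand \<open>e\<close> accounts for the final
  index, after which the potential is not known.\<close>

lemma few_failures:
  fixes q :: "nat \<Rightarrow> real"
  assumes lower: "a \<le> q 0" and upper: "\<And>k. k < K \<Longrightarrow> q k \<le> b"
    and success: "\<And>k. Suc k < K \<Longrightarrow> k \<in> S \<Longrightarrow> q k - c \<le> q (Suc k)"
    and failure: "\<And>k. Suc k < K \<Longrightarrow> k \<notin> S \<Longrightarrow> q k + e \<le> q (Suc k)"
    and nonneg: "0 \<le> c" "0 \<le> e" "a \<le> b"
  shows "e * real (card ({..<K} - S)) \<le> c * real (card ({..<K} \<inter> S)) + (b - a) + e"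
proof -
  have step: "card ({..<Suc k} - S) = (if k \<in> S then 0 else 1) + card ({..<k} - S)"
    "card ({..<Suc k} \<inter> S) = (if k \<in> S then 1 else 0) + card ({..<k} \<inter> S)" for k
    by (auto simp: lessThan_Suc insert_Diff_if)
  have growth: "a + e * real (card ({..<k} - S)) - c * real (card ({..<k} \<inter> S)) \<le> q k"
    if "k < K" for k
    using that
  proof (induction k)
    case (Suc k)
    then show ?case
      using success[of k] failure[of k] by (cases "k \<in> S") (simp_all add: step algebra_simps)
  qed (simp add: lower)
  show ?thesis
  proof (cases K)
    case (Suc k)
    then show ?thesis
      using growth[of k] upper[of k] nonneg by (simp add: step algebra_simps split: if_splits)
  qed (use nonneg in simp)
qed

section \<open>The regularisation weights along a run\<close>

text \<open>After a very successful iteration, \<open>h\<close> does not grow beyond \<open>B\<close>. Any other iteration has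
  \<open>h < (3 \<zeta> + M / 2)\<^sup>2\<close>, and the next value exceeds \<open>\<gamma>\<^sub>3\<^sup>2\<close> times that one by at most the
  tolerance.\<close>

definition h_bound :: "hsodm_param \<Rightarrow> real \<Rightarrow> real \<Rightarrow> real" where
  "h_bound P M B = max B (((gam3 P)\<^sup>2 + kappa P) * (3 * zeta P + M / 2)\<^sup>2 + hmin P)"

locale hsodm_execution = lipschitz_hessian f g H M
  for f :: "real^'n \<Rightarrow> real" and g :: "real^'n \<Rightarrow> real^'n" and H :: "real^'n \<Rightarrow> real^'n^'n"
    and M :: real +
  fixes P :: hsodm_param and x0 :: "real^'n" and N :: nat and r :: "nat \<Rightarrow> (real^'n) iteration"
  assumes param: "valid_param P"
    and run: "hsodm_run P f g H x0 N r"
    and close: "phi_close P g N r"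
begin

abbreviation h :: "nat \<Rightarrow> real" where "h k \<equiv> hval (sol (r k))"
abbreviation d :: "nat \<Rightarrow> real^'n" where "d k \<equiv> step (sol (r k))"
abbreviation successful :: "nat set" where "successful \<equiv> {k. eta1 P \<le> rho f H (r k)}"

lemma param_bounds:
  "0 < hmin P" "0 < eta1 P" "eta1 P < eta2 P" "eta2 P < 1" "1 < gam1 P" "1 < gam2 P"
  "gam2 P \<le> gam3 P" "0 < gam4 P" "gam4 P \<le> 1" "0 < kappa P" "0 < zeta P"
  using param by (simp_all add: valid_param_def)

lemma main_or_hard: "k < N \<Longrightarrow> main_iteration P f g H r k \<or> hard_iteration P g H r k"
  using run by (auto simp: hsodm_run_def split: if_splits)

lemma accepted_solution:
  assumes "k < N"
  shows solution: "ghm_solution (H (pt (r k))) (phi (r k)) (sol (r k))"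
    and solt_nonzero: "solt (sol (r k)) \<noteq> 0"
    and hmin_le: "hmin P \<le> h k"
    and h_pos: "0 < h k"
    and phi_near_gradient: "norm (phi (r k) - g (pt (r k))) \<le> zeta P * (norm (d k))\<^sup>2"
proof -
  have "ghm_solution (H (pt (r k))) (phi (r k)) (sol (r k)) \<and> (\<exists>I. accepted P (tol (r k)) I (sol (r k)))"
    using main_or_hard[OF assms]
    by (auto simp: main_iteration_def hard_iteration_def inner_loop_def Let_def)
       (metis last_in_set)
  then show *: "ghm_solution (H (pt (r k))) (phi (r k)) (sol (r k))" "solt (sol (r k)) \<noteq> 0"
      "hmin P \<le> h k"
    by (auto simp: accepted_def)
  then show "0 < h k"
    using param_bounds(1) by linarith
  show "norm (phi (r k) - g (pt (r k))) \<le> zeta P * (norm (d k))\<^sup>2"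
    using close assms *(2) by (simp add: phi_close_def)
qed

text \<open>The alternatives are the interval prescribed by the previous iteration and the one that the hard-case
  procedure uses, which may be entered after any iteration.\<close>

lemma interval_of_next:
  assumes "Suc k < N"
  obtains I where "accepted P (tol (r (Suc k))) I (sol (r (Suc k)))"
    "I = next_interval P f H (r k) \<or> I = Some (gam2 P * sqrt (h k), gam3 P * sqrt (h k))"
  using main_or_hard[OF assms]
  by (auto simp: main_iteration_def hard_iteration_def cur_interval_def prev_h_def Let_def)

text \<open>A very successful iteration contributes the factor \<open>\<gamma>\<^sub>4\<close>, a merely successful one \<open>1 / \<gamma>\<^sub>1\<close>; entering
  the hard-case procedure only increases the weight.\<close>

lemma sqrt_h_lower:
  assumes "Suc k < N"
  shows "(if k \<in> successful then sqrt (h k) / max (gam1 P) (1 / gam4 P) else gam2 P * sqrt (h k))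
    \<le> sqrt (h (Suc k))"
proof -
  let ?q = "sqrt (h k)" and ?G = "max (gam1 P) (1 / gam4 P)"
  obtain I where I: "accepted P (tol (r (Suc k))) I (sol (r (Suc k)))"
    "I = next_interval P f H (r k) \<or> I = Some (gam2 P * ?q, gam3 P * ?q)"
    using interval_of_next[OF assms] .
  have q: "0 \<le> ?q"
    using h_pos[of k] assms by simp
  have "?q / ?G \<le> ?q / gam1 P"
    using q param_bounds by (intro divide_left_mono) auto
  moreover have "?q / ?G \<le> ?q / (1 / gam4 P)"
    using q param_bounds by (intro divide_left_mono) (auto intro!: mult_pos_pos simp: less_max_iff_disj)
  moreover have "?q / gam1 P \<le> ?q / 1"
    using q param_bounds by (intro divide_left_mono) auto
  moreover have "1 * ?q \<le> gam2 P * ?q"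
    using q param_bounds by (intro mult_right_mono) auto
  ultimately show ?thesis
    using I param_bounds(3)
    by (auto simp: accepted_def within_tol_def next_interval_def Let_def mult.commute
        split: if_splits)
qed

lemma h_upper:
  assumes "Suc k < N" and "rho f H (r k) \<le> eta2 P"
  shows "h (Suc k) \<le> (gam3 P)\<^sup>2 * h k + tol (r (Suc k))"
proof -
  let ?q = "sqrt (h k)" and ?\<sigma> = "tol (r (Suc k))"
  obtain I where I: "accepted P ?\<sigma> I (sol (r (Suc k)))"
    "I = next_interval P f H (r k) \<or> I = Some (gam2 P * ?q, gam3 P * ?q)"
    using interval_of_next[OF assms(1)] .
  have q: "0 \<le> ?q" "?q\<^sup>2 = h k"
    using h_pos[of k] assms(1) by simp_all
  have \<sigma>: "0 < ?\<sigma>"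
    using run assms(1) by (simp add: hsodm_run_def)
  have "\<exists>c\<in>{gam2 P, gam3 P}. sqrt (h (Suc k)) \<le> sqrt ((c * ?q)\<^sup>2 + ?\<sigma>)"
    using I assms(2)
    by (auto simp: accepted_def within_tol_def next_interval_def Let_def split: if_splits)
  then obtain c where c: "c \<in> {gam2 P, gam3 P}" "h (Suc k) \<le> (c * ?q)\<^sup>2 + ?\<sigma>"
    by auto
  have "(c * ?q)\<^sup>2 \<le> (gam3 P * ?q)\<^sup>2"
    using c(1) q(1) param_bounds by (intro power_mono mult_right_mono mult_nonneg_nonneg) auto
  with c(2) q(2) show ?thesis
    by (simp add: power_mult_distrib)
qed

text \<open>One bound that covers both admissible choices of the tolerance.\<close>

lemma tolerance_bound:
  assumes "Suc k < N"
  shows "tol (r (Suc k)) \<le> hmin P + kappa P * h k"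
proof -
  have "0 \<le> kappa P * h k"
    using param_bounds h_pos[of k] assms by simp
  moreover have "tol (r (Suc k)) < hmin P \<or> tol (r (Suc k)) \<le> kappa P * h k"
    using run assms by (auto simp: hsodm_run_def prev_h_def)
  ultimately show ?thesis
    using param_bounds(1) by linarith
qed

lemma h_bounded:
  assumes late: "no_late_increase P f H B N r" and "k < N"
  shows "h k \<le> h_bound P M B"
  using assms(2)
proof (induction k)
  case 0
  then show ?case
    using late by (auto simp: no_late_increase_def h_bound_def)
next
  case (Suc k)
  show ?case
  proof (cases "rho f H (r k) > eta2 P")
    case True
    then have "h (Suc k) \<le> max (h k) B"
      using late Suc.prems by (simp add: no_late_increase_def)
    with Suc show ?thesis
      by (auto simp: h_bound_def)
  next
    case False
    have k: "k < N"
      using Suc.prems by simp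
    have "\<not> 3 * zeta P + M / 2 \<le> sqrt (h k)"
      using ratio_large[OF solution[OF k] solt_nonzero[OF k] h_pos[OF k] phi_near_gradient[OF k]]
        False param_bounds by auto
    then have "(sqrt (h k))\<^sup>2 \<le> (3 * zeta P + M / 2)\<^sup>2"
      using h_pos[OF k] by (intro power_mono) auto
    then have "h k \<le> (3 * zeta P + M / 2)\<^sup>2"
      using h_pos[OF k] by simp
    then have "((gam3 P)\<^sup>2 + kappa P) * h k \<le> ((gam3 P)\<^sup>2 + kappa P) * (3 * zeta P + M / 2)\<^sup>2"
      using param_bounds by (intro mult_left_mono) auto
    moreover have "h (Suc k) \<le> ((gam3 P)\<^sup>2 + kappa P) * h k + hmin P"
      using h_upper[OF Suc.prems] tolerance_bound[OF Suc.prems] False by (simp add: algebra_simps)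
    ultimately show ?thesis
      by (simp add: h_bound_def)
  qed
qed

lemma failures_bounded:
  assumes late: "no_late_increase P f H B N r" and "K \<le> N" "hmin P \<le> h_bound P M B"
  shows "ln (gam2 P) * real (card ({..<K} - successful)) \<le>
    ln (max (gam1 P) (1 / gam4 P)) * real (card ({..<K} \<inter> successful))
    + (ln (sqrt (h_bound P M B)) - ln (sqrt (hmin P))) + ln (gam2 P)"
proof (cases "K = 0")
  case True
  then show ?thesis
    using assms(3) param_bounds by simp
next
  case False
  let ?G = "max (gam1 P) (1 / gam4 P)"
  have G: "1 < ?G"
    using param_bounds by simp
  show ?thesis
  proof (rule few_failures[where q = "\<lambda>k. ln (sqrt (h k))"])
    show "ln (sqrt (hmin P)) \<le> ln (sqrt (h 0))"
      using False assms(2) hmin_le[of 0] h_pos[of 0] param_bounds by simp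
    show "ln (sqrt (h k)) \<le> ln (sqrt (h_bound P M B))" if "k < K" for k
      using h_bounded[OF late, of k] h_pos[of k] that assms(2,3) param_bounds(1) by simp
  next
    fix k assume k: "Suc k < K" "k \<in> successful"
    then have "ln (sqrt (h k) / ?G) \<le> ln (sqrt (h (Suc k)))"
      using sqrt_h_lower[of k] assms(2) h_pos[of k] h_pos[of "Suc k"] G
      by (subst ln_le_cancel_iff) (auto intro!: divide_pos_pos)
    then show "ln (sqrt (h k)) - ln ?G \<le> ln (sqrt (h (Suc k)))"
      using k(1) assms(2) h_pos[of k] G by (subst (asm) ln_div) auto
  next
    fix k assume k: "Suc k < K" "k \<notin> successful"
    then have "ln (gam2 P * sqrt (h k)) \<le> ln (sqrt (h (Suc k)))"
      using sqrt_h_lower[of k] assms(2) h_pos[of k] h_pos[of "Suc k"] param_bounds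
      by (subst ln_le_cancel_iff) auto
    then show "ln (sqrt (h k)) + ln (gam2 P) \<le> ln (sqrt (h (Suc k)))"
      using k(1) assms(2) h_pos[of k] param_bounds by (subst (asm) ln_mult) auto
  qed (use G param_bounds assms(3) in auto)
qed

lemma successes_decrease:
  assumes long: "\<And>k. k < K \<Longrightarrow> k \<in> successful \<Longrightarrow> e \<le> norm (d k)" and "0 \<le> e" "K \<le> N"
  shows "f (pt (r K)) \<le> f x0 - eta1 P * (sqrt (hmin P) / 6 * e ^ 3) * real (card ({..<K} \<inter> successful))"
  using assms(1,3)
proof (induction K)
  case 0
  then show ?case
    using run by (simp add: hsodm_run_def)
next
  case (Suc k)
  let ?c = "eta1 P * (sqrt (hmin P) / 6 * e ^ 3)"
  have k: "k < N"
    using Suc.prems by simp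
  have IH: "f (pt (r k)) \<le> f x0 - ?c * real (card ({..<k} \<inter> successful))"
    using Suc by simp
  have nxt: "pt (r (Suc k)) = next_point P f H (r k)"
    using run k by (simp add: hsodm_run_def)
  show ?case
  proof (cases "k \<in> successful")
    case True
    have "f (pt (r (Suc k))) \<le> f (pt (r k)) - eta1 P * (sqrt (h k) / 6 * norm (d k) ^ 3)"
      using successful_decrease[OF solution[OF k] solt_nonzero[OF k] h_pos[OF k], of "eta1 P"]
        True param_bounds by (simp add: nxt next_point_def)
    moreover have "?c \<le> eta1 P * (sqrt (h k) / 6 * norm (d k) ^ 3)"
      using Suc.prems(1)[of k] True assms(2) hmin_le[OF k] param_bounds
      by (intro mult_mono divide_right_mono power_mono) auto
    ultimately show ?thesis
      using IH True by (simp add: lessThan_Suc ring_distribs)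
  next
    case False
    then show ?thesis
      using IH by (simp add: nxt next_point_def lessThan_Suc)
  qed
qed

end

section \<open>Iteration complexity\<close>

theorem theorem3p1:
  fixes f :: "real^'n \<Rightarrow> real"
    and g :: "real^'n \<Rightarrow> real^'n"
    and H :: "real^'n \<Rightarrow> real^'n^'n"
    and x0 :: "real^'n"
    and P :: hsodm_param
    and flow M B :: real
  assumes gradient: "\<And>x. GDERIV f x :> g x"
    and hessian: "\<And>x. (g has_derivative (\<lambda>u. H x *v u)) (at x)"
    and hessian_cont: "continuous_on UNIV H"
    and hessian_lipschitz: "\<And>x y. onorm (\<lambda>u. (H x - H y) *v u) \<le> M * norm (x - y)"
    and bounded_below: "\<And>x. flow \<le> f x"
    and param: "valid_param P"
  shows "\<exists>C1>0. \<exists>C2>0. \<exists>C3>0. \<forall>\<epsilon> N r.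
    0 < \<epsilon> \<and> \<epsilon> \<le> 1 \<and>
    hsodm_run P f g H x0 N r \<and> phi_close P g N r \<and> no_late_increase P f H B N r \<and>
    C3 * \<epsilon> powr (-3/2) \<le> real N \<longrightarrow>
    (\<exists>k\<le>N. real k \<le> C3 * \<epsilon> powr (-3/2) \<and>
       norm (g (pt (r k))) \<le> C1 * \<epsilon> \<and>
       lambda1 (H (pt (r k))) \<ge> - C2 * sqrt \<epsilon>)"
proof -
  interpret lipschitz_hessian f g H M
    using gradient hessian hessian_lipschitz by unfold_locales
  have par: "0 < hmin P" "0 < eta1 P" "1 < gam1 P" "1 < gam2 P" "0 < kappa P" "0 < zeta P"
    using param by (simp_all add: valid_param_def)
  \<comment> \<open>With \<open>E = \<epsilon> powr (-3/2)\<close>, at most \<open>S * E\<close> successful iterations have steps longer than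
    \<open>sqrt \<epsilon>\<close>, and \<open>S * E\<close> successful iterations can pay for at most \<open>U * E\<close> unsuccessful ones.\<close>
  define b where "b = h_bound P M B"
  define G where "G = max (gam1 P) (1 / gam4 P)"
  define c where "c = eta1 P * (sqrt (hmin P) / 6)"
  define S where "S = (f x0 - flow) / c"
  define U where "U = ln G / ln (gam2 P) * S + (ln (sqrt b) - ln (sqrt (hmin P))) / ln (gam2 P) + 1"
  define C1 where "C1 = M / 2 + zeta P + sqrt b"
  define C2 where "C2 = M + sqrt b"
  define C3 where "C3 = S + U + 1"
  have b: "hmin P \<le> b"
    using par by (simp add: b_def h_bound_def le_max_iff_disj)
  have G: "1 < G"
    using par by (simp add: G_def less_max_iff_disj)
  have c: "0 < c"
    using par by (simp add: c_def)
  have S: "0 \<le> S"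
    using c bounded_below[of x0] by (simp add: S_def)
  have "0 < ln (gam2 P)" "0 < ln G" "0 \<le> ln (sqrt b) - ln (sqrt (hmin P))"
    using par G b by simp_all
  note ln_pos = this
  have U: "1 \<le> U"
    unfolding U_def using ln_pos S by simp
  have "0 < C1" "0 < C2" "0 < C3"
    using M_nonneg par b S U by (auto simp: C1_def C2_def C3_def intro!: add_nonneg_pos)
  moreover have "\<exists>k\<le>N. real k \<le> C3 * \<epsilon> powr (-3/2) \<and> norm (g (pt (r k))) \<le> C1 * \<epsilon> \<and>
      lambda1 (H (pt (r k))) \<ge> - C2 * sqrt \<epsilon>"
    if \<epsilon>: "0 < \<epsilon>" "\<epsilon> \<le> 1" and run: "hsodm_run P f g H x0 N r" and close: "phi_close P g N r"
      and late: "no_late_increase P f H B N r" and long: "C3 * \<epsilon> powr (-3/2) \<le> real N"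
    for \<epsilon> N r
  proof -
    interpret hsodm_execution f g H M P x0 N r
      using param run close by unfold_locales
    \<comment> \<open>As \<open>E \<ge> 1\<close>, additive constants in the counts may be absorbed into multiples of \<open>E\<close>; the
      summand \<open>1\<close> of \<open>C3\<close> makes up for rounding \<open>C3 * E\<close> down to \<open>K\<close>.\<close>
    define E where "E = \<epsilon> powr (-3/2)"
    define K where "K = nat \<lfloor>C3 * E\<rfloor>"
    have E: "1 \<le> E"
      using powr_mono2'[of "-3/2" \<epsilon> 1] \<epsilon> by (simp add: E_def)
    have "sqrt \<epsilon> ^ 3 = \<epsilon> powr (3/2)"
      using \<epsilon> by (simp add: powr_half_sqrt[symmetric] powr_power)
    then have sqrt_E: "sqrt \<epsilon> ^ 3 * E = 1"
      using \<epsilon> by (simp add: E_def flip: powr_add)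
    have "0 \<le> C3 * E"
      using \<open>0 < C3\<close> E by simp
    then have K: "real K \<le> C3 * E" "C3 * E < real K + 1"
      unfolding K_def by linarith+
    then have "K \<le> N"
      using long by (simp add: E_def)
    have "\<exists>k<K. k \<in> successful \<and> norm (d k) \<le> sqrt \<epsilon>"
    proof (rule ccontr)
      assume "\<not> ?thesis"
      then have "sqrt \<epsilon> \<le> norm (d k)" if "k < K" "k \<in> successful" for k
        using that by force
      then have "f (pt (r K)) \<le> f x0
          - eta1 P * (sqrt (hmin P) / 6 * sqrt \<epsilon> ^ 3) * real (card ({..<K} \<inter> successful))"
        using \<open>K \<le> N\<close> \<epsilon> by (intro successes_decrease) auto
      then have "c * sqrt \<epsilon> ^ 3 * real (card ({..<K} \<inter> successful)) \<le> f x0 - flow"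
        using bounded_below[of "pt (r K)"] by (simp add: c_def mult.assoc)
      then have "c * sqrt \<epsilon> ^ 3 * real (card ({..<K} \<inter> successful)) * E \<le> (f x0 - flow) * E"
        using E by (intro mult_right_mono) auto
      moreover have "c * sqrt \<epsilon> ^ 3 * real (card ({..<K} \<inter> successful)) * E
          = c * real (card ({..<K} \<inter> successful)) * (sqrt \<epsilon> ^ 3 * E)"
        by (simp only: ac_simps)
      ultimately have "c * real (card ({..<K} \<inter> successful)) \<le> (f x0 - flow) * E"
        by (simp only: sqrt_E mult_1_right)
      then have succ: "real (card ({..<K} \<inter> successful)) \<le> S * E"
        using c by (simp add: S_def field_simps)
      have "ln (gam2 P) * real (card ({..<K} - successful)) \<le>
          ln G * real (card ({..<K} \<inter> successful)) + (ln (sqrt b) - ln (sqrt (hmin P))) + ln (gam2 P)"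
        using failures_bounded[OF late \<open>K \<le> N\<close>] b by (simp add: G_def b_def)
      also have "\<dots> \<le> ln G * (S * E) + (ln (sqrt b) - ln (sqrt (hmin P))) * E + ln (gam2 P) * E"
        using succ ln_pos E by (intro add_mono mult_left_mono) (auto simp: mult_le_cancel_left1)
      also have "\<dots> = ln (gam2 P) * (U * E)"
        using ln_pos by (simp add: U_def field_simps)
      finally have fail: "real (card ({..<K} - successful)) \<le> U * E"
        using ln_pos(1) by (simp only: mult_le_cancel_left_pos)
      have "K = card ({..<K} \<inter> successful) + card ({..<K} - successful)"
        by (subst card_Un_disjoint[symmetric]) (auto simp: Int_Diff_Un)
      then have "real K \<le> S * E + U * E"
        using succ fail by linarith
      with K(2) E show False
        by (simp add: C3_def ring_distribs)
    qed
    then obtain k where k: "k < K" "k \<in> successful" and short: "norm (d k) \<le> sqrt \<epsilon>"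
      by blast
    have kN: "k < N"
      using k(1) \<open>K \<le> N\<close> by simp
    have next_pt: "pt (r (Suc k)) = pt (r k) + d k"
      using run kN k(2) by (simp add: hsodm_run_def next_point_def)
    have q: "sqrt (h k) \<le> sqrt b"
      using h_bounded[OF late kN] by (simp add: b_def)
    have "(norm (d k))\<^sup>2 \<le> (sqrt \<epsilon>)\<^sup>2"
      using short by (intro power_mono) auto
    then have short2: "(norm (d k))\<^sup>2 \<le> \<epsilon>"
      using \<epsilon> by simp
    have "norm (g (pt (r (Suc k)))) \<le> (M / 2 + zeta P + sqrt (h k)) * (norm (d k))\<^sup>2"
      unfolding next_pt
      by (rule next_gradient[OF solution solt_nonzero h_pos phi_near_gradient]) (rule kN)+
    also have "\<dots> \<le> C1 * \<epsilon>"
      unfolding C1_def using q short2 M_nonneg par h_pos[OF kN] by (intro mult_mono) auto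
    finally have grad: "norm (g (pt (r (Suc k)))) \<le> C1 * \<epsilon>" .
    have "(M + sqrt (h k)) * norm (d k) \<le> C2 * sqrt \<epsilon>"
      unfolding C2_def using q short M_nonneg h_pos[OF kN] \<epsilon> by (intro mult_mono) auto
    moreover have "- ((M + sqrt (h k)) * norm (d k)) \<le> lambda1 (H (pt (r (Suc k))))"
      unfolding next_pt by (rule next_curvature[OF solution solt_nonzero h_pos]) (rule kN)+
    ultimately have curv: "lambda1 (H (pt (r (Suc k)))) \<ge> - C2 * sqrt \<epsilon>"
      by simp
    have "Suc k \<le> N" "real (Suc k) \<le> C3 * \<epsilon> powr (-3/2)"
      using k(1) \<open>K \<le> N\<close> K(1) by (simp_all add: E_def)
    with grad curv show ?thesis
      by blast
  qed
  ultimately show ?thesis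
    by blast
qed

end
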